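(* Let $K$ be a field, $S=K[x_1,\dots,x_n]$, and let $I\subset S$ be a non-zero squarefree monomial ideal. Then: (a) $\mathcal{G}(I_c(I))=\{(x_1\cdots x_n)/u \,:\, u\in\mathcal{G}(I)\}$; (b) $I_c(I_c(I))=I$.
   Context: For a monomial ideal $I\subset S$, $\mathcal{G}(I)$ denotes its unique minimal set of monomial generators. For a non-zero squarefree monomial ideal $I\subset S=K[x_1,\dots,x_n]$, the complementary ideal of $I$ is the ideal $I_c(I)=\big((x_1\cdots x_n)/u \,:\, u\in\mathcal{G}(I)\big)$ of $S$. *)

theory Defs
  imports Complex_Main "HOL-Library.Poly_Mapping"
begin

text \<open>
  The polynomial ring in the variables indexed by \<^typ>\<open>'n\<close> with coefficients in \<^typ>\<open>'k\<close>:
  finitely supported families of coefficients, indexed by exponent vectors.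
\<close>
type_synonym ('n, 'k) mpoly = "('n \<Rightarrow>\<^sub>0 nat) \<Rightarrow>\<^sub>0 'k"

definition monom :: "('n \<Rightarrow>\<^sub>0 nat) \<Rightarrow> ('n, 'k::field) mpoly" where
  "monom a = Poly_Mapping.single a 1"

definition monomials :: "('n, 'k::field) mpoly set" where
  "monomials = range monom"

definition squarefree_monomials :: "('n, 'k::field) mpoly set" where
  "squarefree_monomials = {monom a | a. \<forall>i. Poly_Mapping.lookup a i \<le> 1}"

definition var :: "'n \<Rightarrow> ('n, 'k::field) mpoly" where
  "var i = monom (Poly_Mapping.single i 1)"

text \<open>The ideals of a commutative ring are its submodules as a module over itself.\<close>
definition ideal_of :: "('n, 'k::field) mpoly set \<Rightarrow> ('n, 'k) mpoly set" where
  "ideal_of A = module.span (*) A"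

definition squarefree_monomial_ideal :: "('n, 'k::field) mpoly set \<Rightarrow> bool" where
  "squarefree_monomial_ideal I \<longleftrightarrow> (\<exists>M \<subseteq> squarefree_monomials. I = ideal_of M)"

definition monomial_ideal :: "('n, 'k::field) mpoly set \<Rightarrow> bool" where
  "monomial_ideal I \<longleftrightarrow> (\<exists>M \<subseteq> monomials. I = ideal_of M)"

definition minimal_monomial_generators ::
    "('n, 'k::field) mpoly set \<Rightarrow> ('n, 'k) mpoly set \<Rightarrow> bool" where
  "minimal_monomial_generators I G \<longleftrightarrow>
     G \<subseteq> monomials \<and> ideal_of G = I \<and> (\<forall>H. H \<subset> G \<longrightarrow> ideal_of H \<noteq> I)"

text \<open>Well-defined for monomial ideals by \<open>ex1_minimal_monomial_generators\<close> below.\<close>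
definition min_gens :: "('n, 'k::field) mpoly set \<Rightarrow> ('n, 'k) mpoly set" where
  "min_gens I = (THE G. minimal_monomial_generators I G)"

text \<open>
  The exact quotient \<open>p / u\<close>, for \<open>u\<close> dividing \<open>p\<close>. It is only used for monomials; see
  \<open>exact_quotient_monom\<close> below.
\<close>
definition exact_quotient :: "('n, 'k::field) mpoly \<Rightarrow> ('n, 'k) mpoly \<Rightarrow> ('n, 'k) mpoly" where
  "exact_quotient p u = (THE w. w * u = p)"

definition complementary_ideal ::
    "('n::finite, 'k::field) mpoly set \<Rightarrow> ('n, 'k) mpoly set" where
  "complementary_ideal I = ideal_of {exact_quotient (\<Prod>i\<in>UNIV. var i) u | u. u \<in> min_gens I}"


interpretation mpoly: module "(*) :: ('n, 'k::field) mpoly \<Rightarrow> _"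
  by unfold_locales (auto simp: algebra_simps)

lemma monom_mult: "monom a * monom b = monom (a + b)"
  by (simp add: monom_def mult_single)

lemma monom_inj: "(monom a :: ('n, 'k::field) mpoly) = monom b \<longleftrightarrow> a = b"
proof
  assume *: "(monom a :: ('n, 'k) mpoly) = monom b"
  have "Poly_Mapping.lookup (monom b :: ('n, 'k) mpoly) a = 1" 
    unfolding *[symmetric] by (simp add: monom_def)
  thus "a = b" by (simp add: monom_def lookup_single when_def split: if_splits)
qed simp

lemma monom_mem_ideal_of_iff:
  fixes M :: "('n, 'k::field) mpoly set"
  assumes "M \<subseteq> monomials"
  shows "monom a \<in> ideal_of M \<longleftrightarrow> (\<exists>b c. monom b \<in> M \<and> a = b + c)"
proof
  let ?N = "{p :: ('n, 'k) mpoly. \<forall>k\<in>Poly_Mapping.keys p. \<exists>b c. monom b \<in> M \<and> k = b + c}"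
  have "mpoly.subspace ?N"
  proof (rule mpoly.subspaceI)
    fix x y assume "x \<in> ?N" "y \<in> ?N"
    thus "x + y \<in> ?N" using Poly_Mapping.keys_add[of x y] by blast
  next
    fix c x assume x: "x \<in> ?N"
    show "c * x \<in> ?N"
    proof (clarify)
      fix k assume "k \<in> Poly_Mapping.keys (c * x)"
      then obtain u v where uv: "v \<in> Poly_Mapping.keys x" "k = u + v"
        using keys_mult[of c x] by blast
      then obtain b d where "monom b \<in> M" "v = b + d" using x by blast
      thus "\<exists>b d. monom b \<in> M \<and> k = b + d"
        using uv by (intro exI[of _ b] exI[of _ "u + d"]) (simp add: algebra_simps)
    qed
  qed simp
  moreover have "M \<subseteq> ?N"
  proof
    fix m assume m: "m \<in> M"
    then obtain b where "m = monom b" using assms unfolding monomials_def by blast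
    have "\<exists>d e. monom d \<in> M \<and> b = d + e"
      using m \<open>m = monom b\<close> by (intro exI[of _ b] exI[of _ 0]) simp
    moreover have "Poly_Mapping.keys m = {b}" by (simp add: \<open>m = monom b\<close> monom_def)
    ultimately show "m \<in> ?N" by simp
  qed
  ultimately have "mpoly.span M \<subseteq> ?N" by (simp add: mpoly.span_minimal)
  moreover assume "monom a \<in> ideal_of M"
  ultimately have "monom a \<in> ?N" unfolding ideal_of_def by blast
  thus "\<exists>b c. monom b \<in> M \<and> a = b + c" by (simp add: monom_def)
next
  assume "\<exists>b c. monom b \<in> M \<and> a = b + c"
  then obtain b c where bc: "monom b \<in> M" "a = b + c" by blast
  have "monom c * monom b \<in> mpoly.span M"
    by (intro mpoly.span_scale mpoly.span_base bc)
  thus "monom a \<in> ideal_of M"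
    by (simp add: ideal_of_def monom_mult bc add.commute)
qed

lemma ex1_minimal_monomial_generators:
  fixes I :: "('n::finite, 'k::field) mpoly set"
  assumes "monomial_ideal I"
  shows "\<exists>!G. minimal_monomial_generators I G"
proof -
  obtain M where M: "M \<subseteq> monomials" "I = ideal_of M"
    using assms by (auto simp: monomial_ideal_def)
  define G :: "('n, 'k) mpoly set"
    where "G = {monom a | a. monom a \<in> I \<and> (\<forall>b c. monom b \<in> I \<and> a = b + c \<longrightarrow> c = 0)}"
  have G_mon: "G \<subseteq> monomials" by (auto simp: G_def monomials_def)
  have below: "\<exists>b c. monom b \<in> G \<and> a = b + c" if "monom a \<in> I" for a :: "'n \<Rightarrow>\<^sub>0 nat"
    using that
  proof (induction "\<Sum>i\<in>UNIV. Poly_Mapping.lookup a i" arbitrary: a rule: less_induct)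
    case less
    show ?case
    proof (cases "monom a \<in> G")
      case True
      thus ?thesis by (intro exI[of _ a] exI[of _ 0]) simp
    next
      case False
      then obtain b c where bc: "monom b \<in> I" "a = b + c" "c \<noteq> 0"
        using less.prems by (auto simp: G_def)
      obtain i where "Poly_Mapping.lookup c i \<noteq> 0"
        using bc(3) by (auto simp: poly_mapping_eq_iff fun_eq_iff)
      hence "(\<Sum>i\<in>UNIV. Poly_Mapping.lookup c i) \<noteq> 0"
        by (subst sum_eq_0_iff) auto
      moreover have "(\<Sum>i\<in>UNIV. Poly_Mapping.lookup a i) =
          (\<Sum>i\<in>UNIV. Poly_Mapping.lookup b i) + (\<Sum>i\<in>UNIV. Poly_Mapping.lookup c i)"
        by (simp add: bc(2) lookup_add sum.distrib)
      ultimately have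
        "(\<Sum>i\<in>UNIV. Poly_Mapping.lookup b i) < (\<Sum>i\<in>UNIV. Poly_Mapping.lookup a i)"
        by linarith
      from less.hyps[OF this bc(1)] obtain d e where "monom d \<in> G" "b = d + e" by blast
      thus ?thesis using bc by (intro exI[of _ d] exI[of _ "e + c"]) (simp add: algebra_simps)
    qed
  qed
  have "G \<subseteq> I" by (auto simp: G_def)
  hence "ideal_of G \<subseteq> I"
    unfolding M ideal_of_def by (intro mpoly.span_minimal) simp_all
  moreover have "M \<subseteq> ideal_of G"
  proof
    fix m assume m: "m \<in> M"
    then obtain a where a: "m = monom a" using M by (auto simp: monomials_def)
    have "monom a \<in> I" using m mpoly.span_base unfolding M ideal_of_def a by blast
    thus "m \<in> ideal_of G" using below monom_mem_ideal_of_iff[OF G_mon] a by blast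
  qed
  hence "I \<subseteq> ideal_of G"
    unfolding M(2) ideal_of_def by (intro mpoly.span_minimal) simp_all
  ultimately have G_gen: "ideal_of G = I" by blast
  have G_sub: "G \<subseteq> H" if H: "H \<subseteq> monomials" "ideal_of H = I" for H
  proof
    fix m assume "m \<in> G"
    then obtain a where a: "m = monom a" "monom a \<in> I"
      "\<And>b c. monom b \<in> I \<Longrightarrow> a = b + c \<Longrightarrow> c = 0"
      by (auto simp: G_def)
    then obtain b c where bc: "monom b \<in> H" "a = b + c"
      using monom_mem_ideal_of_iff[OF H(1)] H(2) by blast
    have "monom b \<in> I" using bc(1) H(2) mpoly.span_base unfolding ideal_of_def by blast
    hence "c = 0" using a(3) bc by blast
    thus "m \<in> H" using a bc by simp
  qed
  show ?thesis
  proof (rule ex1I)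
    show "minimal_monomial_generators I G"
      unfolding minimal_monomial_generators_def using G_mon G_gen G_sub by blast
  next
    fix H assume "minimal_monomial_generators I H"
    thus "H = G"
      unfolding minimal_monomial_generators_def using G_mon G_gen G_sub by blast
  qed
qed

lemma exact_quotient_monom:
  fixes a b :: "'n \<Rightarrow>\<^sub>0 nat"
  shows "exact_quotient (monom (a + b)) (monom b) = (monom a :: ('n, 'k::field) mpoly)"
  unfolding exact_quotient_def
proof (rule the_equality)
  show "monom a * monom b = (monom (a + b) :: ('n, 'k) mpoly)" by (simp add: monom_mult)
next
  have lookup_shift: "Poly_Mapping.lookup (p * monom b) (k + b) = Poly_Mapping.lookup p k" for p :: "('n, 'k) mpoly" and k
  proof (induction p rule: update_induct)
    case const
    show ?case by simp
  next
    case (update p j c)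
    have "Poly_Mapping.update j c p = p + Poly_Mapping.single j c"
      using update.hyps
      by (intro poly_mapping_eqI)
         (auto simp: lookup_add lookup_single lookup_update when_def in_keys_iff)
    thus ?case
      using update.IH
      by (simp add: distrib_right lookup_add monom_def mult_single lookup_single when_def)
  qed
  fix w :: "('n, 'k) mpoly"
  assume "w * monom b = monom (a + b)"
  hence "Poly_Mapping.lookup w k = Poly_Mapping.lookup (monom a) k" for k
    using lookup_shift[of w k] lookup_shift[of "monom a" k] by (simp add: monom_mult)
  thus "w = monom a" by (rule poly_mapping_eqI)
qed

end

theory Submission
  imports Defs
begin

text \<open>
  A set of monomials is the minimal generating set of the ideal it generates exactly when no
  member properly divides another (\<open>minimal_generators_iff_antichain\<close>). On squarefree monomials
  the map \<open>u \<mapsto> x\<^sub>1\<cdots>x\<^sub>n / u\<close> is an involution that reverses divisibility, just as complementation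
  of subsets of the variables reverses inclusion. It therefore carries antichains to antichains,
  and so the complements of the minimal generators of \<open>I\<close> are again minimal generators. Applying
  the involution a second time gives the minimal generators of \<open>I\<close> back.
  The argument applies to \<open>I\<close> because the minimal generators of a squarefree monomial ideal
  are themselves squarefree: they occur in every monomial generating set
  (\<open>minimal_generators_subset\<close>).
\<close>

definition divisibility_antichain :: "('n \<Rightarrow>\<^sub>0 nat) set \<Rightarrow> bool" where
  "divisibility_antichain A \<longleftrightarrow> (\<forall>b c. b \<in> A \<and> b + c \<in> A \<longrightarrow> c = 0)"

definition squarefree_exponent :: "('n \<Rightarrow>\<^sub>0 nat) \<Rightarrow> bool" where
  "squarefree_exponent a \<longleftrightarrow> (\<forall>i. Poly_Mapping.lookup a i \<le> 1)"

definition all_ones :: "'n::finite \<Rightarrow>\<^sub>0 nat" where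
  "all_ones = (\<Sum>i\<in>UNIV. Poly_Mapping.single i 1)"

lemma exponent_add_eq_0D:
  fixes c d :: "'n \<Rightarrow>\<^sub>0 nat"
  assumes "c + d = 0"
  shows "c = 0" and "d = 0"
proof -
  have "Poly_Mapping.lookup c i + Poly_Mapping.lookup d i = 0" for i
    using assms by (metis lookup_add lookup_zero)
  thus "c = 0" "d = 0" by (auto intro!: poly_mapping_eqI)
qed

lemma subset_monomials_imp_image: "G \<subseteq> monomials \<Longrightarrow> \<exists>A. G = monom ` A"
  by (simp add: monomials_def subset_image_iff)

lemma monom_image_subset_monomials: "monom ` A \<subseteq> monomials"
  by (auto simp: monomials_def)

lemma monom_mem_image_iff: "(monom a :: ('n, 'k::field) mpoly) \<in> monom ` A \<longleftrightarrow> a \<in> A"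
  by (auto simp: monom_inj)

lemma monom_mem_ideal_of_image_iff:
  "(monom a :: ('n, 'k::field) mpoly) \<in> ideal_of (monom ` A) \<longleftrightarrow> (\<exists>b c. b \<in> A \<and> a = b + c)"
  by (simp add: monom_mem_ideal_of_iff[OF monom_image_subset_monomials] monom_mem_image_iff)

text \<open>
  If \<open>b + c\<close> with \<open>c \<noteq> 0\<close> were in \<open>A\<close> next to \<open>b\<close>, it could be dropped from the generators.
  Conversely, in an antichain each monomial lies in the ideal generated by a subset only if it
  belongs to that subset.
\<close>
lemma minimal_generators_iff_antichain:
  "minimal_monomial_generators (ideal_of (monom ` A)) (monom ` A :: ('n, 'k::field) mpoly set)
     \<longleftrightarrow> divisibility_antichain A"
proof
  assume min: "minimal_monomial_generators (ideal_of (monom ` A))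
    (monom ` A :: ('n, 'k) mpoly set)"
  show "divisibility_antichain A"
    unfolding divisibility_antichain_def
  proof (intro allI impI, rule ccontr)
    fix b c
    assume bc: "b \<in> A \<and> b + c \<in> A" and "c \<noteq> 0"
    let ?B = "A - {b + c}"
    have "b \<in> ?B" using bc \<open>c \<noteq> 0\<close> by simp
    hence "(monom (b + c) :: ('n, 'k) mpoly) \<in> ideal_of (monom ` ?B)"
      unfolding monom_mem_ideal_of_image_iff by blast
    moreover have "(monom ` ?B :: ('n, 'k) mpoly set) \<subseteq> ideal_of (monom ` ?B)"
      unfolding ideal_of_def by (rule mpoly.span_superset)
    ultimately have "(monom ` A :: ('n, 'k) mpoly set) \<subseteq> ideal_of (monom ` ?B)" by auto
    hence "ideal_of (monom ` A) \<subseteq> (ideal_of (monom ` ?B) :: ('n, 'k) mpoly set)"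
      unfolding ideal_of_def by (intro mpoly.span_minimal) simp_all
    moreover have "ideal_of (monom ` ?B) \<subseteq> (ideal_of (monom ` A) :: ('n, 'k) mpoly set)"
      unfolding ideal_of_def by (intro mpoly.span_mono) auto
    moreover have "(monom ` ?B :: ('n, 'k) mpoly set) \<subset> monom ` A"
      using bc monom_mem_image_iff[of "b + c" A, where 'k = 'k]
        monom_mem_image_iff[of "b + c" ?B, where 'k = 'k] by blast
    ultimately show False
      using min unfolding minimal_monomial_generators_def by blast
  qed
next
  assume anti: "divisibility_antichain A"
  have "ideal_of H \<noteq> ideal_of (monom ` A)" if H: "H \<subset> monom ` A" for H :: "('n, 'k) mpoly set"
  proof
    assume eq: "ideal_of H = ideal_of (monom ` A)"
    have "H \<subseteq> monomials"
      by (rule subset_trans[OF psubset_imp_subset[OF H] monom_image_subset_monomials])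
    then obtain B where B: "H = monom ` B" using subset_monomials_imp_image by blast
    have "B \<subseteq> A"
    proof
      fix b assume "b \<in> B"
      hence "(monom b :: ('n, 'k) mpoly) \<in> monom ` A" using H B by blast
      thus "b \<in> A" by (simp add: monom_mem_image_iff)
    qed
    obtain a where a: "a \<in> A" "a \<notin> B" using H B by blast
    have "(monom a :: ('n, 'k) mpoly) \<in> ideal_of (monom ` B)"
      unfolding eq[unfolded B] monom_mem_ideal_of_image_iff
      using a(1) by (metis add.right_neutral)
    then obtain b c where "b \<in> B" "a = b + c"
      unfolding monom_mem_ideal_of_image_iff by blast
    thus False
      using anti a \<open>B \<subseteq> A\<close> unfolding divisibility_antichain_def by fastforce
  qed
  thus "minimal_monomial_generators (ideal_of (monom ` A)) (monom ` A :: ('n, 'k) mpoly set)"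
    by (simp add: minimal_monomial_generators_def monom_image_subset_monomials)
qed

lemma minimal_monomial_generators_min_gens:
  fixes I :: "('n::finite, 'k::field) mpoly set"
  assumes "monomial_ideal I"
  shows "minimal_monomial_generators I (min_gens I)"
  unfolding min_gens_def by (rule theI'[OF ex1_minimal_monomial_generators[OF assms]])

lemma min_gens_ideal_of_antichain:
  fixes A :: "('n::finite \<Rightarrow>\<^sub>0 nat) set"
  assumes "divisibility_antichain A"
  shows "min_gens (ideal_of (monom ` A)) = (monom ` A :: ('n, 'k::field) mpoly set)"
proof -
  let ?I = "ideal_of (monom ` A) :: ('n, 'k) mpoly set"
  have "monomial_ideal ?I"
    unfolding monomial_ideal_def using monom_image_subset_monomials by blast
  moreover have "minimal_monomial_generators ?I (monom ` A)"
    using assms by (simp add: minimal_generators_iff_antichain)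
  ultimately show ?thesis
    unfolding min_gens_def by (intro the1_equality ex1_minimal_monomial_generators)
qed

text \<open>
  A minimal generator \<open>a\<close> is a multiple of some \<open>b\<close> in the other generating set, which in turn
  is a multiple of some minimal generator \<open>d\<close>; by minimality \<open>a = d\<close>, which forces \<open>a = b\<close>.
\<close>
lemma minimal_generators_subset:
  fixes M :: "('n, 'k::field) mpoly set"
  assumes M: "M \<subseteq> monomials"
    and anti: "divisibility_antichain A"
    and gen: "ideal_of (monom ` A) = ideal_of M"
  shows "monom ` A \<subseteq> M"
proof clarify
  fix a assume a: "a \<in> A"
  hence "(monom a :: ('n, 'k) mpoly) \<in> ideal_of (monom ` A)"
    unfolding monom_mem_ideal_of_image_iff by (metis add.right_neutral)
  then obtain b c where bc: "monom b \<in> M" "a = b + c"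
    unfolding gen monom_mem_ideal_of_iff[OF M] by blast
  have "monom b \<in> ideal_of M"
    unfolding ideal_of_def by (rule mpoly.span_base[OF bc(1)])
  hence "(monom b :: ('n, 'k) mpoly) \<in> ideal_of (monom ` A)" by (simp add: gen)
  then obtain d e where de: "d \<in> A" "b = d + e"
    unfolding monom_mem_ideal_of_image_iff by blast
  have "e + c = 0"
    using anti a de bc(2) unfolding divisibility_antichain_def by (metis add.assoc)
  hence "c = 0" by (rule exponent_add_eq_0D)
  thus "monom a \<in> M" using bc by simp
qed

lemma squarefree_monomial_idealE:
  fixes I :: "('n::finite, 'k::field) mpoly set"
  assumes "squarefree_monomial_ideal I"
  obtains A where "divisibility_antichain A" "\<forall>a\<in>A. squarefree_exponent a"
    "I = ideal_of (monom ` A)"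
proof -
  obtain M :: "('n, 'k) mpoly set" where M: "M \<subseteq> squarefree_monomials" "I = ideal_of M"
    using assms by (auto simp: squarefree_monomial_ideal_def)
  have M': "M \<subseteq> monomials"
    using M(1) by (auto simp: squarefree_monomials_def monomials_def)
  hence "minimal_monomial_generators I (min_gens I)"
    using M(2) by (intro minimal_monomial_generators_min_gens) (auto simp: monomial_ideal_def)
  moreover from this have "min_gens I \<subseteq> monomials"
    by (simp add: minimal_monomial_generators_def)
  then obtain A where "min_gens I = monom ` A"
    using subset_monomials_imp_image by blast
  ultimately have min: "minimal_monomial_generators I (monom ` A)" by simp
  hence gen: "I = ideal_of (monom ` A)" by (simp add: minimal_monomial_generators_def)
  have anti: "divisibility_antichain A"
    using min unfolding gen minimal_generators_iff_antichain .
  have "monom ` A \<subseteq> M"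
    using minimal_generators_subset[OF M' anti] gen M(2) by simp
  hence "monom ` A \<subseteq> (squarefree_monomials :: ('n, 'k) mpoly set)"
    using M(1) by (rule subset_trans)
  hence "\<forall>a\<in>A. squarefree_exponent a"
    by (simp add: squarefree_monomials_def squarefree_exponent_def image_subset_iff monom_inj)
  thus thesis using that anti gen by blast
qed

lemma lookup_all_ones: "Poly_Mapping.lookup all_ones i = 1"
proof -
  have "Poly_Mapping.lookup all_ones i = (\<Sum>j\<in>UNIV. Poly_Mapping.lookup (Poly_Mapping.single j 1) i)"
    unfolding all_ones_def by (rule lookup_sum)
  thus ?thesis by (simp add: lookup_single when_def)
qed

lemma prod_var_eq_monom: "(\<Prod>i\<in>UNIV. var i) = (monom all_ones :: ('n::finite, 'k::field) mpoly)"
proof -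
  have "(\<Prod>i\<in>X. var i) = (monom (\<Sum>i\<in>X. Poly_Mapping.single i 1) :: ('n, 'k) mpoly)"
    if "finite X" for X :: "'n set"
    using that by induction (simp_all add: var_def monom_mult, simp add: monom_def)
  thus ?thesis by (simp add: all_ones_def)
qed

lemma all_ones_diff_add:
  assumes "squarefree_exponent a"
  shows "all_ones - a + a = all_ones"
  using assms
  by (intro poly_mapping_eqI)
     (simp add: lookup_add lookup_minus lookup_all_ones squarefree_exponent_def)

lemma squarefree_exponent_complement: "squarefree_exponent (all_ones - a)"
  by (simp add: squarefree_exponent_def lookup_minus lookup_all_ones)

lemma complement_complement:
  assumes "squarefree_exponent a"
  shows "all_ones - (all_ones - a) = a"
  by (metis all_ones_diff_add[OF assms] add_diff_cancel_left')

lemma exact_quotient_prod_var: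
  assumes "squarefree_exponent a"
  shows "exact_quotient (\<Prod>i\<in>UNIV. var i) (monom a)
    = (monom (all_ones - a) :: ('n::finite, 'k::field) mpoly)"
  using exact_quotient_monom[of "all_ones - a" a]
  by (simp add: prod_var_eq_monom all_ones_diff_add[OF assms])

text \<open>
  Complementation reverses divisibility with the same cofactor: if the complement of \<open>a\<close> is \<open>c\<close>
  times the complement of \<open>b\<close>, then \<open>b\<close> is \<open>c\<close> times \<open>a\<close>.
\<close>
lemma divisibility_antichain_complement:
  assumes anti: "divisibility_antichain A" and sf: "\<forall>a\<in>A. squarefree_exponent a"
  shows "divisibility_antichain ((-) all_ones ` A)"
  unfolding divisibility_antichain_def
proof (intro allI impI)
  fix b' c
  assume "b' \<in> (-) all_ones ` A \<and> b' + c \<in> (-) all_ones ` A"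
  then obtain a b where ab: "a \<in> A" "b \<in> A" "all_ones - a = all_ones - b + c" by force
  have "all_ones - b + b = all_ones - b + c + a"
    using all_ones_diff_add sf ab by metis
  hence "b = c + a" by (simp add: add.assoc)
  hence "a + c = b" by (simp add: add.commute)
  thus "c = 0" using anti ab unfolding divisibility_antichain_def by blast
qed

lemma exact_quotients_min_gens:
  fixes A :: "('n::finite \<Rightarrow>\<^sub>0 nat) set"
  assumes "divisibility_antichain A" and sf: "\<forall>a\<in>A. squarefree_exponent a"
  shows "{exact_quotient (\<Prod>i\<in>UNIV. var i) u | u. u \<in> min_gens (ideal_of (monom ` A))}
    = (monom ` (-) all_ones ` A :: ('n, 'k::field) mpoly set)"
proof -
  have "{exact_quotient (\<Prod>i\<in>UNIV. var i) u | u. u \<in> min_gens (ideal_of (monom ` A))}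
      = (\<lambda>a. exact_quotient (\<Prod>i\<in>UNIV. var i) (monom a) :: ('n, 'k) mpoly) ` A"
    unfolding min_gens_ideal_of_antichain[OF assms(1)] by blast
  also have "\<dots> = (\<lambda>a. monom (all_ones - a)) ` A"
    using sf by (intro image_cong refl exact_quotient_prod_var) blast
  finally show ?thesis by (simp add: image_image)
qed

theorem proposition1p1:
  fixes I :: "('n::finite, 'k::field) mpoly set"
  assumes "squarefree_monomial_ideal I" and "I \<noteq> {0}"
  shows "min_gens (complementary_ideal I)
           = {exact_quotient (\<Prod>i\<in>UNIV. var i) u | u. u \<in> min_gens I}
         \<and> complementary_ideal (complementary_ideal I) = I"
proof -
  obtain A where anti: "divisibility_antichain A" and sf: "\<forall>a\<in>A. squarefree_exponent a"
    and I: "I = ideal_of (monom ` A)"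
    using assms(1) by (rule squarefree_monomial_idealE)
  let ?A' = "(-) all_ones ` A"
  have anti': "divisibility_antichain ?A'"
    by (rule divisibility_antichain_complement[OF anti sf])
  have sf': "\<forall>a\<in>?A'. squarefree_exponent a"
    by (simp add: squarefree_exponent_complement)
  have involution: "(-) all_ones ` ?A' = A"
    using sf by (simp add: image_image complement_complement)
  have Ic: "complementary_ideal I = ideal_of (monom ` ?A')"
    unfolding complementary_ideal_def I exact_quotients_min_gens[OF anti sf] ..
  have "complementary_ideal (complementary_ideal I) = I"
    unfolding Ic
    unfolding complementary_ideal_def exact_quotients_min_gens[OF anti' sf'] involution I ..
  moreover have "min_gens (complementary_ideal I)
      = {exact_quotient (\<Prod>i\<in>UNIV. var i) u | u. u \<in> min_gens I}"
    unfolding Ic min_gens_ideal_of_antichain[OF anti']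
    unfolding I exact_quotients_min_gens[OF anti sf] ..
  ultimately show ?thesis by blast
qed

end
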